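(* For any $\alpha\in(0,1/4)$ and $\epsilon_{\max}\in(0,1/2]$ there exists a constant $c>0$ depending only on $\alpha$ and $\epsilon_{\max}$ such that for all integers $n\ge2$, all $\epsilon\in[0,\epsilon_{\max}]$ and all $p\in[\frac1n,1-\frac1n]$, $$r^{\rm ER}_\alpha(\epsilon,p,\epsilon_{\max})\ \ge\ c\left(\sqrt{\frac{p(1-p)}n}+\frac1n\right).$$
   Context: Erdős–Rényi model with node contamination: for $n\ge1$, $p,\epsilon\in[0,1]$, $\mathcal G(n,p,\epsilon)$ is the set of all distributions $P$ of a symmetric adjacency matrix $A\in\{0,1\}^{n\times n}$ with zero diagonal generated as follows. (1) Sample $z_1,\dots,z_n$ i.i.d. $\mathrm{Bernoulli}(\epsilon)$. (2) Conditionally on $(z_i)$, sample $\{A_{ij}\}_{1\le i<j\le n}$ independently: $A_{ij}\sim\mathrm{Bernoulli}(p)$ if $z_i=z_j=0$, and otherwise $A_{ij}$ is drawn from an arbitrary Bernoulli distribution (whose parameter may depend on $i,j$ and on $(z_i)$). Set $A_{ji}=A_{ij}$, $A_{ii}=0$. An interval $[L,U]$ has length $|[L,U]|=U-L$ if $U\ge L$, and is empty (of length $0$) if $U<L$. Class of confidence intervals: $$\mathcal I^{\rm ER}_\alpha(\epsilon_{\max})=\Big\{\widehat{\mathrm{CI}}=[l(A),u(A)]:\ \inf_{p\in[0,1]}\inf_{P\in\mathcal G(n,p,\epsilon_{\max})}P\big(p\in\widehat{\mathrm{CI}}\big)\ge1-\alpha\Big\}.$$ Locally optimal length: $$r^{\rm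 ER}_\alpha(\epsilon,p,\epsilon_{\max})=\inf\Big\{r\ge0:\ \inf_{\widehat{\mathrm{CI}}\in\mathcal I^{\rm ER}_\alpha(\epsilon_{\max})}\ \sup_{P\in\mathcal G(n,p,\epsilon)}P\big(|\widehat{\mathrm{CI}}|\ge r\big)\le\alpha\Big\}.$$ *)

theory Defs
  imports "HOL-Probability.Probability"
begin

text \<open>
  The vertex set is \<open>{..<n}\<close>. A 0/1 adjacency matrix is a function \<open>A i j\<close> with
  \<open>True\<close> for 1 and \<open>False\<close> for 0. Entries outside the \<open>n \<times> n\<close> range are \<open>False\<close>, so
  that each matrix has exactly one representation.
\<close>

type_synonym adjacency = "nat \<Rightarrow> nat \<Rightarrow> bool"

definition upper_pairs :: "nat \<Rightarrow> (nat \<times> nat) set" where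
  "upper_pairs n = {(i, j). i < j \<and> j < n}"

definition symmetrize :: "(nat \<times> nat \<Rightarrow> bool) \<Rightarrow> adjacency" where
  "symmetrize E = (\<lambda>i j. if i < j then E (i, j) else if j < i then E (j, i) else False)"

text \<open>
  \<open>Q z i j\<close>, for \<open>i < j\<close>, is the edge probability chosen by the adversary when the
  contamination indicators are \<open>z\<close>. It is consulted only if \<open>z i\<close> or \<open>z j\<close> holds.
\<close>

definition contaminated_er ::
  "nat \<Rightarrow> real \<Rightarrow> real \<Rightarrow> ((nat \<Rightarrow> bool) \<Rightarrow> nat \<Rightarrow> nat \<Rightarrow> real) \<Rightarrow> adjacency pmf" where
  "contaminated_er n p \<epsilon> Q =
     bind_pmf (Pi_pmf {..<n} False (\<lambda>_. bernoulli_pmf \<epsilon>))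
       (\<lambda>z. map_pmf symmetrize
         (Pi_pmf (upper_pairs n) False
           (\<lambda>(i, j). bernoulli_pmf (if \<not> z i \<and> \<not> z j then p else Q z i j))))"

definition er_model :: "nat \<Rightarrow> real \<Rightarrow> real \<Rightarrow> adjacency pmf set" where
  "er_model n p \<epsilon> = {contaminated_er n p \<epsilon> Q | Q. \<forall>z i j. Q z i j \<in> {0..1}}"

text \<open>A confidence interval is given by its pair of endpoints \<open>(l(A), u(A))\<close>.\<close>

type_synonym conf_int = "adjacency \<Rightarrow> real \<times> real"

definition ci_set :: "real \<times> real \<Rightarrow> real set" where
  "ci_set I = {fst I..snd I}"

definition ci_length :: "real \<times> real \<Rightarrow> real" where
  "ci_length I = (if fst I \<le> snd I then snd I - fst I else 0)"

definition er_ci_class :: "nat \<Rightarrow> real \<Rightarrow> real \<Rightarrow> conf_int set" where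
  "er_ci_class n \<alpha> \<epsilon>max =
     {CI. (INF p\<in>{0..1}. INF P\<in>er_model n p \<epsilon>max.
             measure_pmf.prob P {A. p \<in> ci_set (CI A)}) \<ge> 1 - \<alpha>}"

definition er_opt_length :: "nat \<Rightarrow> real \<Rightarrow> real \<Rightarrow> real \<Rightarrow> real \<Rightarrow> real" where
  "er_opt_length n \<alpha> \<epsilon> p \<epsilon>max =
     Inf {r. r \<ge> 0 \<and>
       (INF CI\<in>er_ci_class n \<alpha> \<epsilon>max. SUP P\<in>er_model n p \<epsilon>.
          measure_pmf.prob P {A. ci_length (CI A) \<ge> r}) \<le> \<alpha>}"

text \<open>
  The infima and suprema above are real-valued, and their range sets are nonempty and
  bounded: probabilities lie in \<open>[0, 1]\<close>, and the next three lemmas give nonemptiness.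
\<close>

lemma er_model_nonempty: "er_model n p \<epsilon> \<noteq> {}"
  unfolding er_model_def by (auto intro!: exI[of _ "\<lambda>_ _ _. 0"])

lemma trivial_interval_in_er_ci_class:
  assumes "\<alpha> \<ge> 0"
  shows "(\<lambda>_. (0, 1)) \<in> er_ci_class n \<alpha> \<epsilon>max"
proof -
  have "(INF P\<in>er_model n p \<epsilon>max. measure_pmf.prob P {A. p \<in> ci_set (0, 1)}) = 1"
    if "p \<in> {0..1}" for p
    using that by (simp add: ci_set_def er_model_nonempty)
  then show ?thesis
    using assms by (simp add: er_ci_class_def)
qed

lemma er_opt_length_set_nonempty:
  assumes "\<alpha> \<ge> 0"
  shows "\<exists>r\<ge>0. (INF CI\<in>er_ci_class n \<alpha> \<epsilon>max. SUP P\<in>er_model n p \<epsilon>.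
            measure_pmf.prob P {A. ci_length (CI A) \<ge> r}) \<le> \<alpha>"
proof (intro exI[of _ 2] conjI)
  let ?f = "\<lambda>CI. SUP P\<in>er_model n p \<epsilon>. measure_pmf.prob P {A. ci_length (CI A) \<ge> 2}"
  have nonneg: "0 \<le> ?f CI" for CI
  proof -
    obtain P where P: "P \<in> er_model n p \<epsilon>"
      using er_model_nonempty by blast
    have "bdd_above ((\<lambda>P. measure_pmf.prob P {A. ci_length (CI A) \<ge> 2}) ` er_model n p \<epsilon>)"
      by (intro bdd_aboveI2[of _ _ 1]) simp
    from cSUP_upper[OF P this] show ?thesis
      using measure_nonneg order_trans by blast
  qed
  have "(INF CI\<in>er_ci_class n \<alpha> \<epsilon>max. ?f CI) \<le> ?f (\<lambda>_. (0, 1))"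
    using trivial_interval_in_er_ci_class[OF assms]
    by (intro cINF_lower bdd_belowI2[of _ 0] nonneg)
  also have "\<dots> = 0"
    by (simp add: ci_length_def er_model_nonempty)
  finally show "(INF CI\<in>er_ci_class n \<alpha> \<epsilon>max. ?f CI) \<le> \<alpha>"
    using assms by simp
qed simp

end

theory Submission
  imports Defs
begin

text \<open>
  The clean Erdos--Renyi graph with edge probability \<open>p\<close> belongs to every contaminated model
  with parameter \<open>p\<close>, whatever the contamination level. It therefore suffices to find a law
  \<open>P'\<close> in the model with parameter \<open>p' = p + \<Delta>\<close> and contamination \<open>\<epsilon>max\<close>, with \<open>\<Delta>\<close> of order
  \<open>sqrt (p * (1 - p) / n)\<close>, whose total variation distance to that clean graph is at most
  \<open>1 / 4\<close>. A valid interval then covers both \<open>p\<close> and \<open>p'\<close> under the clean graph with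
  probability at least \<open>1 - 2 * \<alpha> - 1 / 4\<close>, which exceeds \<open>\<alpha>\<close> since \<open>\<alpha> < 1 / 4\<close>, and on
  this event its length is at least \<open>\<Delta>\<close>. This is \<open>er_opt_length_ge\<close>. The term \<open>1 / n\<close> is
  absorbed, because \<open>1 / n \<le> 2 * sqrt (p * (1 - p) / n)\<close> for \<open>1 / n \<le> p \<le> 1 - 1 / n\<close>.

  The law \<open>P'\<close> is a two-block model. With \<open>x = 1\<close> at a clean node and \<open>x = - (1 - \<epsilon>) / \<epsilon>\<close> at
  a contaminated one, the edge \<open>{i, j}\<close> has probability \<open>p + \<Delta> * x i * x j\<close>. Between clean
  nodes this is \<open>p + \<Delta>\<close>, as the model demands. The labels \<open>x i\<close> are independent with mean
  zero, so all expected degrees agree with those of the clean graph, and what is left is a rank-one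
  perturbation of an amplitude below the detection threshold.

  Closeness follows from a chi-square computation (\<open>mixture_prob_diff_le\<close>). Let \<open>x'\<close> be an
  independent copy of \<open>x\<close> and \<open>\<beta> = \<Delta>\<^sup>2 / (p * (1 - p))\<close>, which is of order \<open>1 / n\<close>.
  The second moment of the likelihood ratio is the expectation of the product over \<open>i < j\<close> of
  \<open>1 + \<beta> * x i * x j * x' i * x' j\<close>, which is at most the expectation of
  \<open>exp (\<beta> / 2 * (\<Sum>i<n. x i * x' i)\<^sup>2)\<close>. The sum has bounded centred independent terms, so
  this exponential moment is close to 1 when \<open>n * \<beta>\<close> is small
  (\<open>expectation_exp_square_sum_le\<close>).
\<close>

section \<open>The second-moment bound for mixtures\<close>

text \<open>
  The chi-square bound on the distance between a mixture and a fixed law: the double expectation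
  over two independent draws \<open>z\<close>, \<open>z'\<close> of the mixing variable is the second moment of the
  likelihood ratio of the mixture.
\<close>
lemma mixture_prob_diff_le:
  fixes W :: "'a pmf" and K :: "'a \<Rightarrow> 'b pmf" and P :: "'b pmf"
  assumes finW: "finite (set_pmf W)" and finP: "finite (set_pmf P)"
    and ac: "\<And>z. set_pmf (K z) \<subseteq> set_pmf P"
    and "\<delta> \<ge> 0"
    and chi: "measure_pmf.expectation W (\<lambda>z. measure_pmf.expectation W (\<lambda>z'.
        measure_pmf.expectation P (\<lambda>e. pmf (K z) e / pmf P e * (pmf (K z') e / pmf P e)))) \<le> 1 + \<delta>\<^sup>2"
  shows "\<bar>measure_pmf.prob (bind_pmf W K) E - measure_pmf.prob P E\<bar> \<le> \<delta>"
proof -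
  define L where "L = (\<lambda>z e. pmf (K z) e / pmf P e)"
  define m where "m = (\<lambda>e. \<Sum>z\<in>set_pmf W. pmf W z * L z e)"
  note intP [simp, intro] = integrable_measure_pmf_finite[OF finP]
  have finK: "finite (set_pmf (K z))" for z
    using ac finP finite_subset by blast
  have prob_K: "measure_pmf.prob (K z) F = measure_pmf.expectation P (\<lambda>e. L z e * indicator F e)" for z F
  proof -
    have "measure_pmf.prob (K z) F = measure_pmf.expectation (K z) (indicator F)"
      by simp
    also have "\<dots> = (\<Sum>e\<in>set_pmf P. pmf (K z) e * indicator F e)"
      using ac[of z] by (subst integral_measure_pmf[OF finP]) auto
    also have "\<dots> = (\<Sum>e\<in>set_pmf P. pmf P e * (L z e * indicator F e))"
      by (intro sum.cong refl) (simp add: L_def pmf_eq_0_set_pmf)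
    also have "\<dots> = measure_pmf.expectation P (\<lambda>e. L z e * indicator F e)"
      by (subst integral_measure_pmf[OF finP]) auto
    finally show ?thesis .
  qed
  have prob_mix: "measure_pmf.prob (bind_pmf W K) F = measure_pmf.expectation P (\<lambda>e. m e * indicator F e)" for F
  proof -
    have "measure_pmf.prob (bind_pmf W K) F = measure_pmf.expectation (bind_pmf W K) (indicator F)"
      by simp
    also have "\<dots> = (\<Sum>z\<in>set_pmf W. pmf W z * measure_pmf.prob (K z) F)"
      by (subst pmf_expectation_bind[OF finW finK]) auto
    also have "\<dots> = (\<Sum>z\<in>set_pmf W. measure_pmf.expectation P (\<lambda>e. pmf W z * L z e * indicator F e))"
      by (simp add: prob_K mult.assoc)
    also have "\<dots> = measure_pmf.expectation P (\<lambda>e. m e * indicator F e)"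
      unfolding m_def sum_distrib_right by (rule Bochner_Integration.integral_sum[symmetric]) simp
    finally show ?thesis .
  qed
  have mean: "measure_pmf.expectation P m = 1"
    using prob_mix[of UNIV] by simp
  have "measure_pmf.expectation P (\<lambda>e. (m e)\<^sup>2) =
      measure_pmf.expectation P (\<lambda>e. \<Sum>z\<in>set_pmf W. \<Sum>z'\<in>set_pmf W. pmf W z * (pmf W z' * (L z e * L z' e)))"
    by (simp add: m_def power2_eq_square sum_product algebra_simps)
  also have "\<dots> = (\<Sum>z\<in>set_pmf W. pmf W z * (\<Sum>z'\<in>set_pmf W. pmf W z' *
      measure_pmf.expectation P (\<lambda>e. L z e * L z' e)))"
    by (simp add: Bochner_Integration.integral_sum sum_distrib_left)
  also have "\<dots> = measure_pmf.expectation W (\<lambda>z. measure_pmf.expectation W (\<lambda>z'.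
        measure_pmf.expectation P (\<lambda>e. L z e * L z' e)))"
    by (simp add: integral_measure_pmf[OF finW])
  also have "\<dots> \<le> 1 + \<delta>\<^sup>2"
    using chi by (simp only: L_def)
  finally have second: "measure_pmf.expectation P (\<lambda>e. (m e)\<^sup>2) \<le> 1 + \<delta>\<^sup>2" .
  define X where "X = (\<lambda>e. (m e - 1) * indicator E e)"
  have diff: "measure_pmf.prob (bind_pmf W K) E - measure_pmf.prob P E = measure_pmf.expectation P X"
  proof -
    have "measure_pmf.expectation P X =
        measure_pmf.expectation P (\<lambda>e. m e * indicator E e - indicator E e)"
      by (simp add: X_def left_diff_distrib)
    also have "\<dots> = measure_pmf.expectation P (\<lambda>e. m e * indicator E e) - measure_pmf.expectation P (indicator E)"
      by (rule Bochner_Integration.integral_diff) auto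
    finally show ?thesis by (simp add: prob_mix)
  qed
  \<comment> \<open>Jensen, in the form that the variance of \<open>X\<close> is nonnegative\<close>
  have "(measure_pmf.expectation P X)\<^sup>2 \<le> measure_pmf.expectation P (\<lambda>e. (X e)\<^sup>2)"
    using measure_pmf.variance_positive[of P X] measure_pmf.variance_eq[of P X] by simp
  also have "\<dots> \<le> measure_pmf.expectation P (\<lambda>e. (m e - 1)\<^sup>2)"
    by (intro integral_mono) (auto simp: X_def indicator_def)
  also have "\<dots> = measure_pmf.expectation P (\<lambda>e. (m e)\<^sup>2) - 1"
    using measure_pmf.variance_eq[of P m] by (simp add: mean)
  also have "\<dots> \<le> \<delta>\<^sup>2"
    using second by simp
  finally have "\<bar>measure_pmf.expectation P X\<bar> \<le> \<delta>"
    using \<open>\<delta> \<ge> 0\<close> by (metis abs_le_square_iff abs_of_nonneg)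
  then show ?thesis
    by (simp add: diff)
qed

section \<open>Exponential moments of squared sums\<close>

lemma exp_le_add_exp_square: "exp x \<le> x + exp (x\<^sup>2)" for x :: real
proof (cases "x \<ge> 1")
  case True
  then have "x \<le> x\<^sup>2"
    by (simp add: power2_eq_square)
  then have "exp x \<le> exp (x\<^sup>2)"
    by simp
  with True show ?thesis by linarith
next
  case False
  have "exp x \<le> 1 + x + x\<^sup>2"
  proof (cases "x \<ge> 0")
    case True
    with False show ?thesis
      by (intro exp_bound) auto
  next
    case neg: False
    define y where "y = - x"
    have y: "y > 0" using neg by (simp add: y_def)
    have low: "1 + y + y\<^sup>2 / 2 \<le> exp y"
      using exp_lower_Taylor_quadratic[of y] y by simp
    have pos: "0 < 1 - y + y\<^sup>2"
    proof -
      have "1 - y + y\<^sup>2 = (y - 1 / 2)\<^sup>2 + 3 / 4"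
        by (simp add: power2_eq_square algebra_simps)
      also have "\<dots> > 0"
        by (intro add_nonneg_pos) auto
      finally show ?thesis .
    qed
    have "1 \<le> (1 - y + y\<^sup>2) * (1 + y + y\<^sup>2 / 2)"
    proof -
      have "(1 - y + y\<^sup>2) * (1 + y + y\<^sup>2 / 2) = 1 + y\<^sup>2 / 2 + y^3 / 2 + y^4 / 2"
        by (simp add: field_simps power2_eq_square power3_eq_cube power4_eq_xxxx)
      then show ?thesis using y by simp
    qed
    also have "\<dots> \<le> (1 - y + y\<^sup>2) * exp y"
      using low pos by (intro mult_left_mono) auto
    finally have "exp (- y) \<le> 1 - y + y\<^sup>2"
      by (simp add: exp_minus field_simps)
    then show ?thesis by (simp add: y_def)
  qed
  also have "\<dots> \<le> x + exp (x\<^sup>2)"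
    using exp_ge_add_one_self[of "x\<^sup>2"] by linarith
  finally show ?thesis .
qed

text \<open>
  A sub-Gaussian bound on the moment generating function of a bounded centred variable, with a
  constant that is not sharp.
\<close>
lemma expectation_exp_centred_le:
  fixes g :: "'a \<Rightarrow> real"
  assumes fin: "finite (set_pmf D)" and bd: "\<And>y. y \<in> set_pmf D \<Longrightarrow> \<bar>g y\<bar> \<le> B"
    and zero: "measure_pmf.expectation D g = 0"
  shows "measure_pmf.expectation D (\<lambda>y. exp (s * g y)) \<le> exp (s\<^sup>2 * B\<^sup>2)"
proof -
  note [simp, intro] = integrable_measure_pmf_finite[OF fin]
  have "measure_pmf.expectation D (\<lambda>y. exp (s * g y)) \<le>
      measure_pmf.expectation D (\<lambda>y. s * g y + exp (s\<^sup>2 * B\<^sup>2))"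
  proof (intro integral_mono_AE; (simp add: AE_measure_pmf_iff)?; (intro ballI)?)
    fix y assume "y \<in> set_pmf D"
    then have "(g y)\<^sup>2 \<le> B\<^sup>2"
      using bd[of y] by (metis abs_ge_zero power2_abs power_mono)
    then have "(s * g y)\<^sup>2 \<le> s\<^sup>2 * B\<^sup>2"
      by (simp add: power_mult_distrib mult_left_mono)
    then have "exp ((s * g y)\<^sup>2) \<le> exp (s\<^sup>2 * B\<^sup>2)"
      by simp
    with exp_le_add_exp_square[of "s * g y"]
    show "exp (s * g y) \<le> s * g y + exp (s\<^sup>2 * B\<^sup>2)"
      by linarith
  qed
  also have "\<dots> = exp (s\<^sup>2 * B\<^sup>2)"
    by (simp add: zero)
  finally show ?thesis .
qed

lemma finite_set_Pi_pmf:
  assumes "finite A" and "\<And>i. i \<in> A \<Longrightarrow> finite (set_pmf (D i))"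
  shows "finite (set_pmf (Pi_pmf A d D))"
  using assms by (auto simp: set_Pi_pmf intro!: finite_PiE_dflt)

lemma expectation_Pi_pmf_insert:
  fixes h :: "('a \<Rightarrow> 'b) \<Rightarrow> real"
  assumes "finite A" and "x \<notin> A" and fin: "\<And>i. i \<in> insert x A \<Longrightarrow> finite (set_pmf (D i))"
  shows "measure_pmf.expectation (Pi_pmf (insert x A) d D) h =
    measure_pmf.expectation (Pi_pmf A d D) (\<lambda>f. measure_pmf.expectation (D x) (\<lambda>y. h (f(x := y))))"
proof -
  have finA: "finite (set_pmf (Pi_pmf A d D))"
    using assms by (intro finite_set_Pi_pmf) auto
  have "Pi_pmf (insert x A) d D = bind_pmf (Pi_pmf A d D) (\<lambda>f. map_pmf (\<lambda>y. f(x := y)) (D x))"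
    unfolding Pi_pmf_insert'[OF assms(1,2)] map_pmf_def by (rule bind_commute_pmf)
  then show ?thesis
    using finA fin[of x]
    by (simp add: pmf_expectation_bind[OF finA] integral_measure_pmf[OF finA, where M = "Pi_pmf A d D"])
qed

text \<open>
  Integrating out one coordinate of \<open>exp (b * W\<^sup>2)\<close>, where \<open>W\<close> is the sum, costs a factor
  \<open>exp (B\<^sup>2 * b)\<close> and turns \<open>b\<close> into \<open>b * (1 + 4 * B\<^sup>2 * b)\<close>. The number \<open>c\<close> bounds the
  coefficient through all \<open>card A\<close> such steps.
\<close>
lemma expectation_exp_square_sum_le:
  fixes g :: "'a \<Rightarrow> 'b \<Rightarrow> real"
  assumes "finite A" and fin: "\<And>i. i \<in> A \<Longrightarrow> finite (set_pmf (D i))"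
    and bd: "\<And>i y. i \<in> A \<Longrightarrow> y \<in> set_pmf (D i) \<Longrightarrow> \<bar>g i y\<bar> \<le> B"
    and zero: "\<And>i. i \<in> A \<Longrightarrow> measure_pmf.expectation (D i) (g i) = 0"
    and "0 \<le> b" and "b * (1 + 4 * B\<^sup>2 * c) ^ card A \<le> c" and "0 \<le> c"
  shows "measure_pmf.expectation (Pi_pmf A d D) (\<lambda>f. exp (b * (\<Sum>i\<in>A. g i (f i))\<^sup>2))
    \<le> exp (real (card A) * (B\<^sup>2 * c))"
  using assms
proof (induction A arbitrary: b rule: finite_induct)
  case empty
  then show ?case by simp
next
  case (insert x A)
  define b' where "b' = b * (1 + 4 * B\<^sup>2 * b)"
  have q: "1 \<le> 1 + 4 * B\<^sup>2 * c" using \<open>0 \<le> c\<close> by simp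
  have "b * 1 \<le> b * (1 + 4 * B\<^sup>2 * c) ^ card (insert x A)"
    using q \<open>0 \<le> b\<close> by (intro mult_left_mono one_le_power) auto
  then have "b \<le> c"
    using insert.prems(5) by simp
  have b': "0 \<le> b'" "b' \<le> b * (1 + 4 * B\<^sup>2 * c)"
    using \<open>0 \<le> b\<close> \<open>b \<le> c\<close> by (auto simp: b'_def intro!: mult_left_mono)
  have "b' * (1 + 4 * B\<^sup>2 * c) ^ card A \<le> (b * (1 + 4 * B\<^sup>2 * c)) * (1 + 4 * B\<^sup>2 * c) ^ card A"
    using b' q by (intro mult_right_mono) auto
  also have "\<dots> \<le> c"
    using insert.prems(5) insert.hyps by (simp add: mult.assoc)
  finally have IH: "measure_pmf.expectation (Pi_pmf A d D) (\<lambda>f. exp (b' * (\<Sum>i\<in>A. g i (f i))\<^sup>2))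
      \<le> exp (real (card A) * (B\<^sup>2 * c))"
    using insert.prems b' by (intro insert.IH) auto
  have finA: "finite (set_pmf (Pi_pmf A d D))"
    using insert by (intro finite_set_Pi_pmf) auto
  have finx: "finite (set_pmf (D x))"
    using insert by auto
  note [simp, intro] = integrable_measure_pmf_finite[OF finA] integrable_measure_pmf_finite[OF finx]
  have inner: "measure_pmf.expectation (D x) (\<lambda>y. exp (b * (g x y + w)\<^sup>2)) \<le>
      exp (B\<^sup>2 * c) * exp (b' * w\<^sup>2)" for w
  proof -
    have "measure_pmf.expectation (D x) (\<lambda>y. exp (b * (g x y + w)\<^sup>2)) \<le>
       measure_pmf.expectation (D x) (\<lambda>y. exp (B\<^sup>2 * c + b * w\<^sup>2) * exp ((2 * b * w) * g x y))"
    proof (intro integral_mono_AE; (simp add: AE_measure_pmf_iff)?; (intro ballI)?)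
      fix y assume "y \<in> set_pmf (D x)"
      then have "\<bar>g x y\<bar> \<le> B"
        using insert.prems(2)[of x y] by simp
      then have "(g x y)\<^sup>2 \<le> B\<^sup>2"
        by (metis abs_ge_zero power2_abs power_mono)
      then have "b * (g x y)\<^sup>2 \<le> c * B\<^sup>2"
        using \<open>b \<le> c\<close> \<open>0 \<le> b\<close> by (intro mult_mono) auto
      then have "b * (g x y + w)\<^sup>2 \<le> (B\<^sup>2 * c + b * w\<^sup>2) + (2 * b * w) * g x y"
        by (simp add: power2_eq_square algebra_simps)
      then show "exp (b * (g x y + w)\<^sup>2) \<le> exp (B\<^sup>2 * c + b * w\<^sup>2) * exp ((2 * b * w) * g x y)"
        by (simp flip: exp_add)
    qed
    also have "\<dots> = exp (B\<^sup>2 * c + b * w\<^sup>2) * measure_pmf.expectation (D x) (\<lambda>y. exp ((2 * b * w) * g x y))"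
      by simp
    also have "\<dots> \<le> exp (B\<^sup>2 * c + b * w\<^sup>2) * exp ((2 * b * w)\<^sup>2 * B\<^sup>2)"
      using insert.prems(2,3) finx by (intro mult_left_mono expectation_exp_centred_le) auto
    also have "\<dots> = exp (B\<^sup>2 * c) * exp (b' * w\<^sup>2)"
      by (simp add: b'_def power2_eq_square algebra_simps flip: exp_add)
    finally show ?thesis .
  qed
  have "measure_pmf.expectation (Pi_pmf (insert x A) d D) (\<lambda>f. exp (b * (\<Sum>i\<in>insert x A. g i (f i))\<^sup>2))
    = measure_pmf.expectation (Pi_pmf A d D) (\<lambda>f. measure_pmf.expectation (D x)
        (\<lambda>y. exp (b * (g x y + (\<Sum>i\<in>A. g i (f i)))\<^sup>2)))"
  proof -
    have "(\<Sum>i\<in>A. g i ((f(x := y)) i)) = (\<Sum>i\<in>A. g i (f i))" for f y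
      using insert.hyps by (intro sum.cong) auto
    then show ?thesis
      using insert.hyps insert.prems by (subst expectation_Pi_pmf_insert) auto
  qed
  also have "\<dots> \<le> measure_pmf.expectation (Pi_pmf A d D)
      (\<lambda>f. exp (B\<^sup>2 * c) * exp (b' * (\<Sum>i\<in>A. g i (f i))\<^sup>2))"
    by (intro integral_mono) (auto intro: inner)
  also have "\<dots> = exp (B\<^sup>2 * c) * measure_pmf.expectation (Pi_pmf A d D)
      (\<lambda>f. exp (b' * (\<Sum>i\<in>A. g i (f i))\<^sup>2))"
    by simp
  also have "\<dots> \<le> exp (B\<^sup>2 * c) * exp (real (card A) * (B\<^sup>2 * c))"
    using IH by (intro mult_left_mono) auto
  also have "\<dots> = exp (real (card (insert x A)) * (B\<^sup>2 * c))"
    using insert.hyps by (simp add: algebra_simps flip: exp_add)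
  finally show ?case .
qed


section \<open>Likelihood ratios of random graphs with independent edges\<close>

lemma finite_upper_pairs: "finite (upper_pairs n)"
  by (rule finite_subset[of _ "{..<n} \<times> {..<n}"]) (auto simp: upper_pairs_def)

lemma sum_upper_pairs_le:
  fixes u :: "nat \<Rightarrow> real"
  shows "2 * (\<Sum>(i, j)\<in>upper_pairs n. u i * u j) \<le> (\<Sum>i<n. u i)\<^sup>2"
proof -
  have "2 * (\<Sum>(i, j)\<in>upper_pairs n. u i * u j) = (\<Sum>i<n. u i)\<^sup>2 - (\<Sum>i<n. (u i)\<^sup>2)"
  proof (induction n)
    case 0
    then show ?case by (simp add: upper_pairs_def)
  next
    case (Suc n)
    have "upper_pairs (Suc n) = upper_pairs n \<union> (\<lambda>i. (i, n)) ` {..<n}"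
      by (auto simp: upper_pairs_def)
    moreover have "upper_pairs n \<inter> (\<lambda>i. (i, n)) ` {..<n} = {}"
      by (auto simp: upper_pairs_def)
    moreover have "(\<Sum>(i, j)\<in>(\<lambda>i. (i, n)) ` {..<n}. u i * u j) = (\<Sum>i<n. u i) * u n"
      by (subst sum.reindex) (auto simp: inj_on_def sum_distrib_right)
    ultimately have "(\<Sum>(i, j)\<in>upper_pairs (Suc n). u i * u j) =
        (\<Sum>(i, j)\<in>upper_pairs n. u i * u j) + (\<Sum>i<n. u i) * u n"
      by (simp add: sum.union_disjoint finite_upper_pairs)
    with Suc show ?case
      by (simp add: power2_eq_square algebra_simps)
  qed
  then show ?thesis
    by (simp add: sum_nonneg)
qed

lemma bernoulli_likelihood_ratio_product:
  assumes "0 < p" "p < 1" "q \<in> {0..1}" "q' \<in> {0..1}"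
  shows "measure_pmf.expectation (bernoulli_pmf p)
      (\<lambda>v. pmf (bernoulli_pmf q) v / pmf (bernoulli_pmf p) v *
        (pmf (bernoulli_pmf q') v / pmf (bernoulli_pmf p) v)) = 1 + (q - p) * (q' - p) / (p * (1 - p))"
    (is "?L = _")
proof -
  have "?L = q * q' / p + (1 - q) * (1 - q') / (1 - p)"
    using assms by simp
  also have "\<dots> = (q * q' * (1 - p) + (1 - q) * (1 - q') * p) / (p * (1 - p))"
    using assms by (simp add: add_frac_eq)
  also have "q * q' * (1 - p) + (1 - q) * (1 - q') * p = p * (1 - p) + (q - p) * (q' - p)"
    by algebra
  finally show ?thesis
    using assms by (simp add: add_divide_distrib)
qed

lemma Pi_bernoulli_likelihood_ratio_product:
  assumes "finite U" "0 < p" "p < 1" and q: "\<And>u. q u \<in> {0..1}" "\<And>u. q' u \<in> {0..1}"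
  shows "measure_pmf.expectation (Pi_pmf U False (\<lambda>_. bernoulli_pmf p))
      (\<lambda>e. pmf (Pi_pmf U False (\<lambda>u. bernoulli_pmf (q u))) e / pmf (Pi_pmf U False (\<lambda>_. bernoulli_pmf p)) e *
        (pmf (Pi_pmf U False (\<lambda>u. bernoulli_pmf (q' u))) e / pmf (Pi_pmf U False (\<lambda>_. bernoulli_pmf p)) e))
    = (\<Prod>u\<in>U. 1 + (q u - p) * (q' u - p) / (p * (1 - p)))" (is "?L = _")
proof -
  let ?r = "\<lambda>u v. pmf (bernoulli_pmf (q u)) v / pmf (bernoulli_pmf p) v *
        (pmf (bernoulli_pmf (q' u)) v / pmf (bernoulli_pmf p) v)"
  have "?L = measure_pmf.expectation (Pi_pmf U False (\<lambda>_. bernoulli_pmf p)) (\<lambda>e. \<Prod>u\<in>U. ?r u (e u))"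
  proof (intro integral_cong_AE; (simp add: AE_measure_pmf_iff)?; (intro ballI)?)
    fix e assume "e \<in> set_pmf (Pi_pmf U False (\<lambda>_. bernoulli_pmf p))"
    then have "e u = False" if "u \<notin> U" for u
      using set_Pi_pmf_subset[OF \<open>finite U\<close>, of False "\<lambda>_. bernoulli_pmf p"] that by blast
    then have "pmf (Pi_pmf U False D) e = (\<Prod>u\<in>U. pmf (D u) (e u))" for D
      by (rule pmf_Pi'[OF \<open>finite U\<close>])
    then show "pmf (Pi_pmf U False (\<lambda>u. bernoulli_pmf (q u))) e *
         pmf (Pi_pmf U False (\<lambda>u. bernoulli_pmf (q' u))) e /
         (pmf (Pi_pmf U False (\<lambda>_. bernoulli_pmf p)) e * pmf (Pi_pmf U False (\<lambda>_. bernoulli_pmf p)) e) =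
        (\<Prod>u\<in>U. pmf (bernoulli_pmf (q u)) (e u) * pmf (bernoulli_pmf (q' u)) (e u) /
         (pmf (bernoulli_pmf p) (e u) * pmf (bernoulli_pmf p) (e u)))"
      by (simp only: prod_dividef prod.distrib)
  qed
  also have "\<dots> = (\<Prod>u\<in>U. measure_pmf.expectation (bernoulli_pmf p) (?r u))"
    by (intro expectation_prod_Pi_pmf \<open>finite U\<close>) (auto intro: integrable_measure_pmf_finite)
  also have "\<dots> = (\<Prod>u\<in>U. 1 + (q u - p) * (q' u - p) / (p * (1 - p)))"
    using q \<open>0 < p\<close> \<open>p < 1\<close> by (intro prod.cong refl bernoulli_likelihood_ratio_product) auto
  finally show ?thesis .
qed

section \<open>A contaminated graph that resembles a clean one\<close>

text \<open>
  The label of a node as a function of its contamination indicator: 1 at a clean node, and at a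
  contaminated node the value that makes the mean zero when contamination has probability \<open>\<epsilon>\<close>.
\<close>
definition balanced_label :: "real \<Rightarrow> bool \<Rightarrow> real" where
  "balanced_label \<epsilon> b = (if b then - ((1 - \<epsilon>) / \<epsilon>) else 1)"

lemma expectation_balanced_label:
  assumes "0 < \<epsilon>" "\<epsilon> \<le> 1"
  shows "measure_pmf.expectation (bernoulli_pmf \<epsilon>) (balanced_label \<epsilon>) = 0"
  using assms by (simp add: balanced_label_def field_simps)

lemma abs_balanced_label_le:
  assumes "0 < \<epsilon>" "\<epsilon> \<le> 1 / 2"
  shows "\<bar>balanced_label \<epsilon> b\<bar> \<le> (1 - \<epsilon>) / \<epsilon>"
  using assms by (auto simp: balanced_label_def field_simps)

lemma er_in_er_model:
  assumes "p \<in> {0..1}"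
  shows "map_pmf symmetrize (Pi_pmf (upper_pairs n) False (\<lambda>_. bernoulli_pmf p)) \<in> er_model n p \<epsilon>"
proof -
  have "map_pmf symmetrize (Pi_pmf (upper_pairs n) False (\<lambda>_. bernoulli_pmf p)) =
      contaminated_er n p \<epsilon> (\<lambda>_ _ _. p)"
    by (simp add: contaminated_er_def case_prod_beta')
  with assms show ?thesis
    unfolding er_model_def by blast
qed

text \<open>
  Up to total variation distance \<open>1 / 4\<close>, contamination can hide a shift \<open>\<Delta>\<close> of the edge
  probability. The two bounds on \<open>\<Delta> * M\<^sup>2\<close> keep the edge probabilities within \<open>[0, 1]\<close>, and
  the last assumption makes the exponential moment of the overlap at most \<open>exp (1 / 64)\<close>.
\<close>
lemma er_close_to_shifted_contaminated_er:
  fixes n :: nat and p \<epsilon> \<Delta> :: real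
  defines "M \<equiv> (1 - \<epsilon>) / \<epsilon>"
  assumes \<epsilon>: "0 < \<epsilon>" "\<epsilon> \<le> 1 / 2" and p: "0 < p" "p < 1"
    and "0 \<le> \<Delta>" and \<Delta>p: "\<Delta> * M\<^sup>2 \<le> p" "\<Delta> * M\<^sup>2 \<le> 1 - p"
    and small: "real n * (\<Delta> * M\<^sup>2)\<^sup>2 \<le> p * (1 - p) / 64"
  shows "\<exists>P\<in>er_model n (p + \<Delta>) \<epsilon>. \<forall>E.
    \<bar>measure_pmf.prob P E -
      measure_pmf.prob (map_pmf symmetrize (Pi_pmf (upper_pairs n) False (\<lambda>_. bernoulli_pmf p))) E\<bar> \<le> 1 / 4"
proof -
  let ?x = "balanced_label \<epsilon>"
  let ?U = "upper_pairs n"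
  define q where "q = (\<lambda>z (i, j). p + \<Delta> * (?x (z i) * ?x (z (j::nat))))"
  define W where "W = Pi_pmf {..<n} False (\<lambda>_. bernoulli_pmf \<epsilon>)"
  define K where "K = (\<lambda>z. Pi_pmf ?U False (\<lambda>u. bernoulli_pmf (q z u)))"
  define P0 where "P0 = Pi_pmf ?U False (\<lambda>_. bernoulli_pmf p)"
  define \<beta> where "\<beta> = \<Delta>\<^sup>2 / (p * (1 - p))"
  have x: "\<bar>?x a\<bar> \<le> M" for a
    using abs_balanced_label_le[OF \<epsilon>] by (simp add: M_def)
  have M: "0 \<le> M"
    using \<epsilon> by (simp add: M_def)
  have xx: "\<bar>?x a * ?x b\<bar> \<le> M\<^sup>2" for a b
    unfolding abs_mult power2_eq_square using x M by (intro mult_mono) auto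
  have q: "q z u \<in> {0..1}" for z u
  proof -
    obtain i j where u: "u = (i, j)" by fastforce
    have "\<bar>\<Delta> * (?x (z i) * ?x (z j))\<bar> \<le> \<Delta> * M\<^sup>2"
      using xx[of "z i" "z j"] \<open>0 \<le> \<Delta>\<close> by (simp add: abs_mult mult_left_mono)
    with \<Delta>p show ?thesis
      unfolding u q_def by auto
  qed
  have finW: "finite (set_pmf W)"
    unfolding W_def by (intro finite_set_Pi_pmf) auto
  have finP0: "finite (set_pmf P0)"
    unfolding P0_def by (intro finite_set_Pi_pmf finite_upper_pairs) auto
  have ac: "set_pmf (K z) \<subseteq> set_pmf P0" for z
    using p by (auto simp: K_def P0_def set_Pi_pmf finite_upper_pairs PiE_dflt_def)
  have \<beta>: "0 \<le> \<beta>" "real n * ((M\<^sup>2)\<^sup>2 * \<beta>) \<le> 1 / 64"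
  proof -
    show "0 \<le> \<beta>" using p by (simp add: \<beta>_def)
    have "real n * ((M\<^sup>2)\<^sup>2 * \<beta>) = real n * (\<Delta> * M\<^sup>2)\<^sup>2 / (p * (1 - p))"
      by (simp add: \<beta>_def power_mult_distrib)
    also have "\<dots> \<le> 1 / 64"
      using small p by (simp add: field_simps)
    finally show "real n * ((M\<^sup>2)\<^sup>2 * \<beta>) \<le> 1 / 64" .
  qed
  have overlap: "measure_pmf.expectation P0 (\<lambda>e. pmf (K z) e / pmf P0 e * (pmf (K z') e / pmf P0 e))
      \<le> exp (\<beta> / 2 * (\<Sum>i<n. ?x (z' i) * ?x (z i))\<^sup>2)" for z z'
  proof -
    define u where "u = (\<lambda>i. ?x (z' i) * ?x (z i))"
    have "measure_pmf.expectation P0 (\<lambda>e. pmf (K z) e / pmf P0 e * (pmf (K z') e / pmf P0 e))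
        = (\<Prod>e\<in>?U. 1 + (q z e - p) * (q z' e - p) / (p * (1 - p)))"
      unfolding P0_def K_def
      by (rule Pi_bernoulli_likelihood_ratio_product[OF finite_upper_pairs p q q])
    also have "\<dots> \<le> (\<Prod>e\<in>?U. exp ((q z e - p) * (q z' e - p) / (p * (1 - p))))"
    proof (intro prod_mono conjI exp_ge_add_one_self)
      fix e
      \<comment> \<open>Each factor is the expectation of a product of two likelihood ratios.\<close>
      show "0 \<le> 1 + (q z e - p) * (q z' e - p) / (p * (1 - p))"
        unfolding bernoulli_likelihood_ratio_product[OF p q q, symmetric]
        by (intro Bochner_Integration.integral_nonneg) auto
    qed
    also have "\<dots> = exp (\<Sum>e\<in>?U. (q z e - p) * (q z' e - p) / (p * (1 - p)))"
      by (simp add: exp_sum finite_upper_pairs)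
    also have "(\<Sum>e\<in>?U. (q z e - p) * (q z' e - p) / (p * (1 - p))) =
        \<beta> * (\<Sum>(i, j)\<in>?U. u i * u j)"
      unfolding sum_distrib_left
      by (intro sum.cong refl) (auto simp: q_def u_def \<beta>_def power2_eq_square)
    also have "\<dots> \<le> \<beta> / 2 * (\<Sum>i<n. u i)\<^sup>2"
      using mult_left_mono[OF sum_upper_pairs_le[of u n] \<beta>(1)] by simp
    finally show ?thesis by (simp add: u_def)
  qed
  \<comment> \<open>For a fixed \<open>z'\<close> the overlap is already a sum of independent centred terms in \<open>z\<close>,
     so no averaging over \<open>z'\<close> is needed.\<close>
  have second: "measure_pmf.expectation W (\<lambda>z. measure_pmf.expectation P0
      (\<lambda>e. pmf (K z') e / pmf P0 e * (pmf (K z) e / pmf P0 e))) \<le> 1 + (1 / 4)\<^sup>2" for z'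
  proof -
    have "(1 + 4 * (M\<^sup>2)\<^sup>2 * \<beta>) ^ n \<le> exp (4 * (M\<^sup>2)\<^sup>2 * \<beta>) ^ n"
      using \<beta> by (intro power_mono exp_ge_add_one_self) auto
    also have "\<dots> = exp (4 * (real n * ((M\<^sup>2)\<^sup>2 * \<beta>)))"
      by (simp add: mult_ac flip: exp_of_nat_mult)
    also have "\<dots> \<le> exp (1 / 2)"
      using \<beta> by simp
    also have "\<dots> \<le> 2"
      by (rule exp_half_le2)
    finally have "\<beta> / 2 * (1 + 4 * (M\<^sup>2)\<^sup>2 * \<beta>) ^ n \<le> \<beta> / 2 * 2"
      using \<beta> by (intro mult_left_mono) auto
    then have growth: "\<beta> / 2 * (1 + 4 * (M\<^sup>2)\<^sup>2 * \<beta>) ^ card {..<n} \<le> \<beta>"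
      by simp
    have "measure_pmf.expectation W (\<lambda>z. measure_pmf.expectation P0
      (\<lambda>e. pmf (K z') e / pmf P0 e * (pmf (K z) e / pmf P0 e)))
      \<le> measure_pmf.expectation W (\<lambda>z. exp (\<beta> / 2 * (\<Sum>i<n. ?x (z' i) * ?x (z i))\<^sup>2))"
      using overlap[of _ z']
      by (intro integral_mono integrable_measure_pmf_finite finW) (simp add: mult.commute)
    also have "\<dots> \<le> exp (real (card {..<n}) * ((M\<^sup>2)\<^sup>2 * \<beta>))"
      unfolding W_def
      using xx \<beta> growth expectation_balanced_label[of \<epsilon>] \<epsilon>
      by (intro expectation_exp_square_sum_le) auto
    also have "\<dots> \<le> exp (1 / 64)"
      using \<beta> by simp
    also have "\<dots> \<le> 1 + (1 / 4)\<^sup>2"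
      using exp_bound[of "1 / 64"] by (simp add: power2_eq_square)
    finally show ?thesis .
  qed
  have close: "\<bar>measure_pmf.prob (bind_pmf W K) E - measure_pmf.prob P0 E\<bar> \<le> 1 / 4" for E
  proof (intro mixture_prob_diff_le finW finP0 ac)
    show "measure_pmf.expectation W (\<lambda>z. measure_pmf.expectation W (\<lambda>z'.
        measure_pmf.expectation P0 (\<lambda>e. pmf (K z) e / pmf P0 e * (pmf (K z') e / pmf P0 e)))) \<le> 1 + (1 / 4)\<^sup>2"
      by (intro measure_pmf.integral_le_const integrable_measure_pmf_finite finW AE_I2 second)
  qed auto
  have "contaminated_er n (p + \<Delta>) \<epsilon> (\<lambda>z i j. q z (i, j)) = map_pmf symmetrize (bind_pmf W K)"
  proof -
    have "(\<lambda>(i, j). bernoulli_pmf (if \<not> z i \<and> \<not> z j then p + \<Delta> else q z (i, j))) =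
        (\<lambda>u. bernoulli_pmf (q z u))" for z
      by (auto simp: fun_eq_iff q_def balanced_label_def)
    then show ?thesis
      by (simp add: contaminated_er_def map_bind_pmf W_def K_def)
  qed
  then have "map_pmf symmetrize (bind_pmf W K) \<in> er_model n (p + \<Delta>) \<epsilon>"
    using q unfolding er_model_def by (auto intro!: exI[of _ "\<lambda>z i j. q z (i, j)"])
  then show ?thesis
    using close by (intro bexI[of _ "map_pmf symmetrize (bind_pmf W K)"]) (auto simp: P0_def)
qed

section \<open>From indistinguishability to interval length\<close>

lemma er_ci_class_coverage:
  assumes "CI \<in> er_ci_class n \<alpha> \<epsilon>" "p \<in> {0..1}" "P \<in> er_model n p \<epsilon>"
  shows "1 - \<alpha> \<le> measure_pmf.prob P {A. p \<in> ci_set (CI A)}"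
proof -
  let ?f = "\<lambda>p. INF P\<in>er_model n p \<epsilon>. measure_pmf.prob P {A. p \<in> ci_set (CI A)}"
  have "1 - \<alpha> \<le> (INF p\<in>{0..1}. ?f p)"
    using assms(1) by (simp add: er_ci_class_def)
  also have "\<dots> \<le> ?f p"
    using assms(2) er_model_nonempty
    by (intro cINF_lower bdd_belowI2[of _ 0]) (auto intro!: cINF_greatest)
  also have "\<dots> \<le> measure_pmf.prob P {A. p \<in> ci_set (CI A)}"
    using assms(3) by (intro cINF_lower bdd_belowI2[of _ 0]) auto
  finally show ?thesis .
qed

lemma prob_long_ci_ge:
  assumes CI: "CI \<in> er_ci_class n \<alpha> \<epsilon>"
    and p: "p \<in> {0..1}" "p' \<in> {0..1}" and r: "r \<le> p' - p" and "0 \<le> p' - p"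
    and P: "P \<in> er_model n p \<epsilon>" "P' \<in> er_model n p' \<epsilon>"
    and close: "\<And>E. \<bar>measure_pmf.prob P' E - measure_pmf.prob P E\<bar> \<le> \<delta>"
  shows "1 - 2 * \<alpha> - \<delta> \<le> measure_pmf.prob P {A. ci_length (CI A) \<ge> r}"
proof -
  let ?A = "{A. p \<in> ci_set (CI A)}" and ?B = "{A. p' \<in> ci_set (CI A)}"
  have "1 - \<alpha> \<le> measure_pmf.prob P ?A" "1 - \<alpha> \<le> measure_pmf.prob P' ?B"
    using er_ci_class_coverage[OF CI] p P by auto
  moreover have "\<bar>measure_pmf.prob P' ?B - measure_pmf.prob P ?B\<bar> \<le> \<delta>"
    by (rule close)
  moreover have "measure_pmf.prob P (?A \<union> ?B) =
      measure_pmf.prob P ?A + measure_pmf.prob P ?B - measure_pmf.prob P (?A \<inter> ?B)"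
    by (simp add: measure_Un3 measure_pmf.fmeasurable_eq_sets)
  moreover have "measure_pmf.prob P (?A \<union> ?B) \<le> 1"
    by simp
  moreover have "measure_pmf.prob P (?A \<inter> ?B) \<le> measure_pmf.prob P {A. ci_length (CI A) \<ge> r}"
    using r \<open>0 \<le> p' - p\<close>
    by (intro measure_pmf.finite_measure_mono) (auto simp: ci_set_def ci_length_def)
  ultimately show ?thesis by linarith
qed

text \<open>
  Le Cam's two-point argument. Only \<open>P\<close> has to belong to the less contaminated model, since the
  length is evaluated under \<open>P\<close>; coverage is required of both laws at level \<open>\<epsilon>max\<close>.
\<close>
lemma er_opt_length_ge:
  assumes "0 \<le> \<alpha>" and "\<delta> < 1 - 3 * \<alpha>"
    and p: "p \<in> {0..1}" "p' \<in> {0..1}" and "p \<le> p'"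
    and P: "P \<in> er_model n p \<epsilon>" "P \<in> er_model n p \<epsilon>max" "P' \<in> er_model n p' \<epsilon>max"
    and close: "\<And>E. \<bar>measure_pmf.prob P' E - measure_pmf.prob P E\<bar> \<le> \<delta>"
  shows "p' - p \<le> er_opt_length n \<alpha> \<epsilon> p \<epsilon>max"
  unfolding er_opt_length_def
proof (rule cInf_greatest)
  show "{r. r \<ge> 0 \<and> (INF CI\<in>er_ci_class n \<alpha> \<epsilon>max. SUP P\<in>er_model n p \<epsilon>.
          measure_pmf.prob P {A. ci_length (CI A) \<ge> r}) \<le> \<alpha>} \<noteq> {}"
    unfolding ex_in_conv[symmetric] mem_Collect_eq
    by (rule er_opt_length_set_nonempty[OF \<open>0 \<le> \<alpha>\<close>])
next
  fix r
  assume "r \<in> {r. r \<ge> 0 \<and> (INF CI\<in>er_ci_class n \<alpha> \<epsilon>max. SUP P\<in>er_model n p \<epsilon>.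
          measure_pmf.prob P {A. ci_length (CI A) \<ge> r}) \<le> \<alpha>}"
  then have INF: "(INF CI\<in>er_ci_class n \<alpha> \<epsilon>max. SUP P\<in>er_model n p \<epsilon>.
          measure_pmf.prob P {A. ci_length (CI A) \<ge> r}) \<le> \<alpha>"
    by simp
  show "p' - p \<le> r"
  proof (rule ccontr)
    assume "\<not> p' - p \<le> r"
    then have r: "r \<le> p' - p" by simp
    have "1 - 2 * \<alpha> - \<delta> \<le> (INF CI\<in>er_ci_class n \<alpha> \<epsilon>max. SUP P\<in>er_model n p \<epsilon>.
          measure_pmf.prob P {A. ci_length (CI A) \<ge> r})"
    proof (rule cINF_greatest)
      show "er_ci_class n \<alpha> \<epsilon>max \<noteq> {}"
        using trivial_interval_in_er_ci_class[OF \<open>0 \<le> \<alpha>\<close>] by blast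
    next
      fix CI assume "CI \<in> er_ci_class n \<alpha> \<epsilon>max"
      then have "1 - 2 * \<alpha> - \<delta> \<le> measure_pmf.prob P {A. ci_length (CI A) \<ge> r}"
        using p r \<open>p \<le> p'\<close> P close by (intro prob_long_ci_ge[where p' = p' and P' = P']) auto
      also have "\<dots> \<le> (SUP P\<in>er_model n p \<epsilon>. measure_pmf.prob P {A. ci_length (CI A) \<ge> r})"
        using P by (intro cSUP_upper bdd_aboveI2[of _ _ 1]) auto
      finally show "1 - 2 * \<alpha> - \<delta> \<le> \<dots>" .
    qed
    with INF \<open>\<delta> < 1 - 3 * \<alpha>\<close> show False by linarith
  qed
qed

section \<open>The lower bound\<close>

lemma standard_deviation_bounds:
  assumes "n \<ge> 2" and p: "p \<in> {1 / real n..1 - 1 / real n}"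
  defines "s \<equiv> sqrt (p * (1 - p) / real n)"
  shows "s \<le> p" "s \<le> 1 - p" "1 / real n \<le> 2 * s"
proof -
  have n: "real n \<ge> 2" using assms by simp
  have pn: "1 / real n \<le> p" "1 / real n \<le> 1 - p" using p by auto
  have p01: "0 < p" "p < 1" using n pn
    by (smt (verit) divide_pos_pos)+
  have "p * (1 - p) / real n = (1 - p) * p * (1 / real n)" by simp
  also have "\<dots> \<le> 1 * p * p"
    using p01 pn n by (intro mult_mono) auto
  finally show "s \<le> p"
    unfolding s_def using p01 by (intro real_le_lsqrt) (auto simp: power2_eq_square)
  have "p * (1 - p) / real n = p * (1 - p) * (1 / real n)" by simp
  also have "\<dots> \<le> 1 * (1 - p) * (1 - p)"
    using p01 pn n by (intro mult_mono) auto
  finally show "s \<le> 1 - p"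
    unfolding s_def using p01 by (intro real_le_lsqrt) (auto simp: power2_eq_square)
  \<comment> \<open>One of \<open>p\<close>, \<open>1 - p\<close> is at least \<open>1 / 2\<close>, and the other at least \<open>1 / n\<close>.\<close>
  have "1 / (2 * real n) \<le> p * (1 - p)"
  proof (cases "p \<le> 1 / 2")
    case True
    have "1 / (2 * real n) = 1 / real n * (1 / 2)" by simp
    also have "\<dots> \<le> p * (1 - p)"
      using True pn p01 n by (intro mult_mono) auto
    finally show ?thesis .
  next
    case False
    have "1 / (2 * real n) = 1 / 2 * (1 / real n)" by simp
    also have "\<dots> \<le> p * (1 - p)"
      using False pn p01 n by (intro mult_mono) auto
    finally show ?thesis .
  qed
  then have "(1 / (2 * real n))\<^sup>2 \<le> p * (1 - p) / real n"
    using n by (simp add: field_simps power2_eq_square)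
  then have "1 / (2 * real n) \<le> s"
    unfolding s_def by (rule real_le_rsqrt)
  then show "1 / real n \<le> 2 * s" by simp
qed

theorem theorem10:
  fixes \<alpha> \<epsilon>max :: real
  assumes "0 < \<alpha>" and "\<alpha> < 1/4" and "0 < \<epsilon>max" and "\<epsilon>max \<le> 1/2"
  shows "\<exists>c>0. \<forall>(n::nat) \<epsilon> p. n \<ge> 2 \<longrightarrow> \<epsilon> \<in> {0..\<epsilon>max} \<longrightarrow> p \<in> {1 / real n..1 - 1 / real n} \<longrightarrow>
           er_opt_length n \<alpha> \<epsilon> p \<epsilon>max \<ge> c * (sqrt (p * (1 - p) / real n) + 1 / real n)"
proof -
  define M where "M = (1 - \<epsilon>max) / \<epsilon>max"
  \<comment> \<open>The constant \<open>1 / 8\<close> makes \<open>n * (\<Delta> * M\<^sup>2)\<^sup>2 = p * (1 - p) / 64\<close> for \<open>\<Delta> = c0 * s\<close> below.\<close>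
  define c0 where "c0 = 1 / (8 * M\<^sup>2)"
  have "1 \<le> M"
    using assms by (simp add: M_def field_simps)
  then have "1 \<le> M\<^sup>2"
    by (rule one_le_power)
  then have M2: "0 < 8 * M\<^sup>2" "1 \<le> 8 * M\<^sup>2"
    by linarith+
  then have "0 < c0" and "c0 \<le> 1"
    unfolding c0_def by (simp_all only: divide_le_eq_1_pos zero_less_divide_1_iff)
  have c0M: "c0 * M\<^sup>2 = 1 / 8"
    using M2 by (simp add: c0_def)
  show ?thesis
  proof (intro exI[of _ "c0 / 3"] conjI allI impI)
    show "0 < c0 / 3" using \<open>0 < c0\<close> by simp
  next
    fix n :: nat and \<epsilon> p :: real
    assume n: "n \<ge> 2" and "\<epsilon> \<in> {0..\<epsilon>max}" and p: "p \<in> {1 / real n..1 - 1 / real n}"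
    define s where "s = sqrt (p * (1 - p) / real n)"
    have s: "s \<le> p" "s \<le> 1 - p" "1 / real n \<le> 2 * s"
      using standard_deviation_bounds[OF n p] by (simp_all add: s_def)
    have "0 < 1 / real n" using n by simp
    with s have "0 < s" by linarith
    then have p01: "0 < p" "p < 1" using s by auto
    have s2: "real n * s\<^sup>2 = p * (1 - p)"
      using n p01 by (simp add: s_def)
    define \<Delta> where "\<Delta> = c0 * s"
    have \<Delta>M: "\<Delta> * M\<^sup>2 = s / 8"
      using c0M by (simp add: \<Delta>_def mult_ac)
    have \<Delta>: "0 \<le> \<Delta>" "\<Delta> \<le> s"
      using \<open>0 < c0\<close> \<open>c0 \<le> 1\<close> \<open>0 < s\<close> by (auto simp: \<Delta>_def mult_left_le_one_le)
    let ?P = "map_pmf symmetrize (Pi_pmf (upper_pairs n) False (\<lambda>_. bernoulli_pmf p))"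
    have "\<exists>P'\<in>er_model n (p + \<Delta>) \<epsilon>max. \<forall>E.
        \<bar>measure_pmf.prob P' E - measure_pmf.prob ?P E\<bar> \<le> 1 / 4"
      using assms p01 \<Delta> \<Delta>M s \<open>0 < s\<close> s2
      by (intro er_close_to_shifted_contaminated_er) (auto simp: power_divide simp flip: M_def)
    then obtain P' where P': "P' \<in> er_model n (p + \<Delta>) \<epsilon>max"
      and close: "\<And>E. \<bar>measure_pmf.prob P' E - measure_pmf.prob ?P E\<bar> \<le> 1 / 4"
      by blast
    have "p + \<Delta> - p \<le> er_opt_length n \<alpha> \<epsilon> p \<epsilon>max"
      using assms p01 \<Delta> s P' close
      by (intro er_opt_length_ge[where P = ?P and P' = P' and \<delta> = "1 / 4"] er_in_er_model) auto
    moreover have "c0 / 3 * (s + 1 / real n) \<le> c0 / 3 * (3 * s)"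
      using \<open>0 < c0\<close> s by (intro mult_left_mono) auto
    ultimately show "c0 / 3 * (sqrt (p * (1 - p) / real n) + 1 / real n) \<le> er_opt_length n \<alpha> \<epsilon> p \<epsilon>max"
      by (simp add: \<Delta>_def s_def)
  qed
qed

end
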